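(* For $|q|<1$, \begin{align*} &\sum_{k=0}^\infty \frac{q^{k^2}(-1;q)_{2k}(-1;q^2)_k}{(q^2;q^2)_{2k}}=\frac{1}{2}\left(3\frac{(q^2;q^2)_\infty^3}{(q;q)_\infty^2(q^4;q^4)_\infty}-\frac{(q;q)_\infty^2(q^2;q^2)_\infty}{(q^4;q^4)_\infty}\right),\\ &\sum_{k=0}^\infty \frac{q^{k^2+2k}(-1;q)_{2k}(-1;q^2)_k}{(q^2;q^2)_{2k}}=\frac{1}{2}\left(\frac{(q^2;q^2)_\infty^3}{(q;q)_\infty^2(q^4;q^4)_\infty}+\frac{(q;q)_\infty^2(q^2;q^2)_\infty}{(q^4;q^4)_\infty}\right),\\ &\sum_{k=0}^\infty \frac{q^{k^2+k}(-1;q)_{2k+1}(-q;q^2)_k}{(q^2;q^2)_{2k+1}}=\frac{1}{2}\left(3\frac{(q^4;q^4)_\infty}{(q;q)_\infty}+\frac{(q;q)_\infty^3(q^4;q^4)_\infty}{(q^2;q^2)_\infty^2}\right),\\ &\sum_{k=0}^\infty \frac{q^{k^2+3k+1}(-1;q)_{2k+1}(-q;q^2)_k}{(q^2;q^2)_{2k+1}}=\frac{1}{2}\left(\frac{(q^4;q^4)_\infty}{(q;q)_\infty}-\frac{(q;q)_\infty^3(q^4;q^4)_\infty}{(q^2;q^2)_\infty^2}\right). \end{align*}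
   Context: For a complex number $a$ and $|q|<1$, $(a;q)_n:=\prod_{k=0}^{n-1}(1-aq^k)$ for $n\in\mathbb{N}\cup\{\infty\}$. *)

theory Defs
  imports "HOL-Analysis.Analysis"
begin

definition qpoch :: "complex \<Rightarrow> complex \<Rightarrow> nat \<Rightarrow> complex" where
  "qpoch a q n = (\<Prod>k<n. 1 - a * q ^ k)"

definition qpoch_inf :: "complex \<Rightarrow> complex \<Rightarrow> complex" where
  "qpoch_inf a q = (\<Prod>k. 1 - a * q ^ k)"

end

theory Submission
  imports Defs
begin

text \<open>
  Put $Q = q^2$. Expanding $(b;Q)_k (d/b)^k/(d;Q)_k$ by the $q$-Vandermonde sum and interchanging the
  order of summation turns a ${}_3\phi_2$ series with lower parameter $aQ$, in the limit where one
  upper parameter tends to infinity, into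
  $(Q;Q)_\infty/(a;Q)_\infty \sum_n (a;Q)_n (d/b;Q)_n Q^n/((Q;Q)_n (d;Q)_n)$. The second and the
  fourth series of the theorem have this shape, and so do the differences of the first two and of
  the last two. In each of the four cases the transformed series is the even or the odd part of
  $\sum_m (-1;q)_m q^m/(q;q)_m$, which the $q$-binomial theorem evaluates at $q$ and at $-q$.
\<close>

section \<open>Finite q-Pochhammer symbols\<close>

lemma qpoch_0 [simp]: "qpoch a q 0 = 1"
  by (simp add: qpoch_def)

lemma qpoch_Suc: "qpoch a q (Suc n) = qpoch a q n * (1 - a * q ^ n)"
  by (simp add: qpoch_def)

lemma qpoch_Suc_shift: "qpoch a q (Suc n) = (1 - a) * qpoch (a * q) q n"
  unfolding qpoch_def by (subst prod.lessThan_Suc_shift) (simp add: mult.assoc)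

lemma qpoch_double: "qpoch a q (2 * n) = qpoch a (q^2) n * qpoch (a * q) (q^2) n"
  by (induction n) (simp_all add: qpoch_Suc algebra_simps power_add flip: power_mult)

lemma qpoch_double_Suc:
  "qpoch a q (2 * n + 1) = qpoch a (q^2) (Suc n) * qpoch (a * q) (q^2) n"
  using qpoch_double[of a q n] by (simp add: qpoch_Suc power_mult)

lemma qpoch_mult_minus: "qpoch a q n * qpoch (-a) q n = qpoch (a^2) (q^2) n"
  by (induction n) (simp_all add: qpoch_Suc algebra_simps power2_eq_square power_mult_distrib)

lemma qpoch_nonzero: "(\<And>k. a * q ^ k \<noteq> 1) \<Longrightarrow> qpoch a q n \<noteq> 0"
  by (auto simp: qpoch_def)

lemma mult_power_neq_1:
  fixes a q :: complex
  assumes "norm q < 1" "norm a < 1"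
  shows "a * q ^ k \<noteq> 1"
proof -
  have "norm (a * q ^ k) \<le> norm a * 1"
    unfolding norm_mult norm_power using assms by (intro mult_left_mono power_le_one) auto
  with assms show ?thesis by (metis mult_1_right norm_one not_less)
qed

section \<open>Infinite q-Pochhammer products\<close>

lemma abs_convergent_prod_qpoch:
  fixes a q :: complex
  assumes "norm q < 1"
  shows "abs_convergent_prod (\<lambda>k. 1 - a * q ^ k)"
  unfolding abs_convergent_prod_conv_summable
  using assms by (simp add: norm_mult norm_power)

lemma qpoch_tendsto:
  assumes "norm q < 1"
  shows "qpoch a q \<longlonglongrightarrow> qpoch_inf a q"
proof -
  have "(\<lambda>n. \<Prod>k\<le>n. 1 - a * q ^ k) \<longlonglongrightarrow> qpoch_inf a q"
    unfolding qpoch_inf_def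
    by (intro convergent_prod_LIMSEQ abs_convergent_prod_imp_convergent_prod
        abs_convergent_prod_qpoch assms)
  then have "(\<lambda>n. qpoch a q (Suc n)) \<longlonglongrightarrow> qpoch_inf a q"
    by (simp add: qpoch_def lessThan_Suc_atMost)
  then show ?thesis by (rule LIMSEQ_imp_Suc)
qed

lemma qpoch_inf_nonzero:
  assumes "norm q < 1" "\<And>k. a * q ^ k \<noteq> 1"
  shows "qpoch_inf a q \<noteq> 0"
  unfolding qpoch_inf_def
  by (intro prodinf_nonzero abs_convergent_prod_imp_convergent_prod abs_convergent_prod_qpoch)
    (use assms in auto)

lemma qpoch_inf_eqI:
  assumes "norm q < 1" "qpoch a q \<longlonglongrightarrow> L"
  shows "qpoch_inf a q = L"
  using LIMSEQ_unique[OF qpoch_tendsto assms(2)] assms(1) by blast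

lemma norm_power2_less_1: "norm (q :: complex) < 1 \<Longrightarrow> norm (q^2) < 1"
  by (simp add: norm_power power_less_one_iff)

lemma qpoch_inf_shift:
  assumes "norm q < 1"
  shows "qpoch_inf a q = (1 - a) * qpoch_inf (a * q) q"
proof (rule qpoch_inf_eqI[OF assms])
  have "(\<lambda>n. qpoch a q (Suc n)) \<longlonglongrightarrow> (1 - a) * qpoch_inf (a * q) q"
    unfolding qpoch_Suc_shift by (intro tendsto_intros qpoch_tendsto assms)
  then show "qpoch a q \<longlonglongrightarrow> (1 - a) * qpoch_inf (a * q) q" by (rule LIMSEQ_imp_Suc)
qed

lemma qpoch_inf_double:
  assumes "norm q < 1"
  shows "qpoch_inf a q = qpoch_inf a (q^2) * qpoch_inf (a * q) (q^2)"
proof -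
  have "(\<lambda>n. qpoch a q (2 * n)) \<longlonglongrightarrow> qpoch_inf a (q^2) * qpoch_inf (a * q) (q^2)"
    unfolding qpoch_double by (intro tendsto_intros qpoch_tendsto norm_power2_less_1 assms)
  moreover have "(\<lambda>n. qpoch a q (2 * n)) \<longlonglongrightarrow> qpoch_inf a q"
    using LIMSEQ_subseq_LIMSEQ[OF qpoch_tendsto[OF assms], of "\<lambda>n. 2 * n"]
    by (simp add: strict_mono_def o_def)
  ultimately show ?thesis using LIMSEQ_unique by blast
qed

lemma qpoch_inf_mult_minus:
  assumes "norm q < 1"
  shows "qpoch_inf a q * qpoch_inf (-a) q = qpoch_inf (a^2) (q^2)"
proof (rule qpoch_inf_eqI[symmetric, OF norm_power2_less_1[OF assms]])
  have "(\<lambda>n. qpoch a q n * qpoch (-a) q n) \<longlonglongrightarrow> qpoch_inf a q * qpoch_inf (-a) q"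
    by (intro tendsto_intros qpoch_tendsto assms)
  then show "qpoch (a^2) (q^2) \<longlonglongrightarrow> qpoch_inf a q * qpoch_inf (-a) q"
    unfolding qpoch_mult_minus .
qed

section \<open>Ratio test and Tannery limits\<close>

text \<open>The ratio test, phrased by a recurrence instead of a quotient so that \<open>f\<close>
  may have zero terms, as happens when a factor of a q-Pochhammer symbol vanishes.\<close>

lemma summable_norm_ratio_limit:
  fixes f :: "nat \<Rightarrow> complex"
  assumes rec: "\<And>n. f (Suc n) = r n * f n" and "r \<longlonglongrightarrow> l" "norm l < 1"
  shows "summable (\<lambda>n. norm (f n))"
proof -
  obtain c where c: "norm l < c" "c < 1" using assms(3) dense by blast
  have "\<forall>\<^sub>F n in sequentially. norm (r n) < c"
    using order_tendstoD(2)[OF tendsto_norm[OF assms(2)] c(1)] .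
  then obtain N where N: "\<And>n. n \<ge> N \<Longrightarrow> norm (r n) < c"
    unfolding eventually_sequentially by blast
  show ?thesis
  proof (rule summable_ratio_test[OF c(2)])
    fix n assume "n \<ge> N"
    then show "norm (norm (f (Suc n))) \<le> c * norm (norm (f n))"
      using N[of n] unfolding rec norm_mult by (simp add: mult_right_mono)
  qed
qed

text \<open>Continuity of a power series at 0 along the points \<open>q ^ n\<close>, by Tannery's
  theorem with majorant \<open>norm (c m)\<close>. It supplies the limit after a functional equation
  has been iterated.\<close>

lemma powser_contract_tendsto:
  fixes c :: "nat \<Rightarrow> complex"
  assumes "summable (\<lambda>m. norm (c m))" "norm q < 1"
  shows "(\<lambda>n. \<Sum>m. c m * (q ^ n) ^ m) \<longlonglongrightarrow> c 0"
proof -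
  define b where "b = (\<lambda>m::nat. if m = 0 then c 0 else 0)"
  have "b sums c 0"
    using sums_single[of 0 "\<lambda>_. c 0"] by (simp add: b_def)
  moreover have "(\<lambda>n. \<Sum>m. c m * (q ^ n) ^ m) \<longlonglongrightarrow> suminf b"
  proof (rule tannerys_theorem[THEN conjunct2, THEN conjunct2])
    show "(\<lambda>n. c m * (q ^ n) ^ m) \<longlonglongrightarrow> b m" for m
    proof (cases "m = 0")
      case False
      then have "norm (q ^ m) < 1" using assms(2) by (simp add: norm_power power_less_one_iff)
      then have "(\<lambda>n. (q ^ m) ^ n) \<longlonglongrightarrow> 0" by (rule LIMSEQ_power_zero)
      then have "(\<lambda>n. c m * (q ^ n) ^ m) \<longlonglongrightarrow> c m * 0"
        by (intro tendsto_intros) (simp add: mult.commute flip: power_mult)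
      then show ?thesis using False by (simp add: b_def)
    qed (simp add: b_def)
    have "norm (c m * (q ^ n) ^ m) \<le> norm (c m)" for m n
      using assms(2) by (simp add: norm_mult norm_power mult_left_le power_le_one)
    then show "\<forall>\<^sub>F (m, n) in at_top \<times>\<^sub>F sequentially. norm (c m * (q ^ n) ^ m) \<le> norm (c m)"
      by (intro always_eventually) auto
  qed (use assms in auto)
  ultimately show ?thesis using sums_unique by force
qed

section \<open>Euler's expansion of the infinite product\<close>

text \<open>The coefficients of Euler's expansion of \<open>qpoch_inf z q\<close> in powers of
  \<open>z\<close>.\<close>

definition qexp_coeff :: "complex \<Rightarrow> nat \<Rightarrow> complex" where
  "qexp_coeff q m = (-1) ^ m * q ^ (m * (m - 1) div 2) / qpoch q q m"

lemma qexp_coeff_0 [simp]: "qexp_coeff q 0 = 1"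
  by (simp add: qexp_coeff_def)

lemma qpoch_q_nonzero: "norm q < 1 \<Longrightarrow> qpoch q q n \<noteq> 0"
  by (intro qpoch_nonzero mult_power_neq_1)

lemma one_minus_power_nonzero:
  fixes q :: complex
  shows "norm q < 1 \<Longrightarrow> 1 - q ^ Suc m \<noteq> 0"
  using mult_power_neq_1[of q q m] by simp

text \<open>Kept in multiplied-out form because \<open>1 - q ^ Suc m\<close> is the factor that
  appears when a power series at \<open>z * q\<close> is subtracted from the one at
  \<open>z\<close>.\<close>

lemma qexp_coeff_Suc:
  assumes "norm q < 1"
  shows "qexp_coeff q (Suc m) * (1 - q ^ Suc m) = - (q ^ m) * qexp_coeff q m"
proof -
  have "Suc m * (Suc m - 1) div 2 = m * (m - 1) div 2 + m"
    by (cases m) (simp_all add: algebra_simps)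
  then have *: "q ^ (Suc m * (Suc m - 1) div 2) = q ^ (m * (m - 1) div 2) * q ^ m"
    by (simp only: power_add)
  show ?thesis
    unfolding qexp_coeff_def * qpoch_Suc
    using one_minus_power_nonzero[OF assms, of m] qpoch_q_nonzero[OF assms, of m]
    by (simp add: field_simps)
qed

lemma one_minus_power_tendsto:
  fixes a q :: complex
  assumes "norm q < 1"
  shows "(\<lambda>n. 1 - a * q ^ n) \<longlonglongrightarrow> 1"
proof -
  have "(\<lambda>n. 1 - a * q ^ n) \<longlonglongrightarrow> 1 - a * 0"
    by (intro tendsto_intros LIMSEQ_power_zero assms)
  then show ?thesis by simp
qed

lemma summable_norm_qexp:
  assumes "norm q < 1"
  shows "summable (\<lambda>m. norm (qexp_coeff q m * z ^ m))"
proof (rule summable_norm_ratio_limit)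
  show "qexp_coeff q (Suc m) * z ^ Suc m
      = (- (q ^ m) / (1 - q * q ^ m) * z) * (qexp_coeff q m * z ^ m)" for m
  proof -
    have "qexp_coeff q (Suc m) = (- (q ^ m) * qexp_coeff q m) / (1 - q ^ Suc m)"
      using qexp_coeff_Suc[OF assms, of m] one_minus_power_nonzero[OF assms, of m]
      by (intro nonzero_eq_divide_eq[THEN iffD2])
    then show ?thesis by simp
  qed
  have "(\<lambda>m. - (q ^ m) / (1 - q * q ^ m) * z) \<longlonglongrightarrow> - 0 / 1 * z"
    by (intro tendsto_intros LIMSEQ_power_zero one_minus_power_tendsto assms) auto
  then show "(\<lambda>m. - (q ^ m) / (1 - q * q ^ m) * z) \<longlonglongrightarrow> 0" by simp
qed auto

text \<open>\<open>G\<close> is arbitrary because the lemma serves both for Euler's series and for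
  the infinite product itself.\<close>

lemma qpoch_iterate:
  assumes "\<And>z. G z = (1 - z) * G (z * q)"
  shows "G z = qpoch z q n * G (z * q ^ n)"
proof (induction n)
  case (Suc n)
  then show ?case using assms[of "z * q ^ n"] by (simp add: qpoch_Suc mult_ac)
qed simp

text \<open>Comparing coefficients gives the series the functional equation of the product,
  \<open>G z = (1 - z) * G (z * q)\<close>. Iteration moves the argument to 0, where the series has
  the value 1.\<close>

lemma qexp_sums:
  assumes "norm q < 1"
  shows "(\<lambda>m. qexp_coeff q m * z ^ m) sums qpoch_inf z q"
proof -
  define G where "G z = (\<Sum>m. qexp_coeff q m * z ^ m)" for z
  have summ: "summable (\<lambda>m. qexp_coeff q m * z ^ m)" for z
    using summable_norm_qexp[OF assms] by (rule summable_norm_cancel)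
  then have G: "(\<lambda>m. qexp_coeff q m * z ^ m) sums G z" for z
    by (simp add: G_def summable_sums)
  have rec: "G z = (1 - z) * G (z * q)" for z
  proof -
    have "(\<lambda>m. qexp_coeff q m * z ^ m - qexp_coeff q m * (z * q) ^ m) sums (G z - G (z * q))"
      by (intro sums_diff G)
    \<comment> \<open>The two terms of index 0 cancel, so the difference series may start at index
      1.\<close>
    then have "(\<lambda>m. qexp_coeff q (Suc m) * z ^ Suc m - qexp_coeff q (Suc m) * (z * q) ^ Suc m)
        sums (G z - G (z * q))"
      by (subst sums_Suc_iff) simp
    moreover have "qexp_coeff q (Suc m) * z ^ Suc m - qexp_coeff q (Suc m) * (z * q) ^ Suc m
        = - z * (qexp_coeff q m * (z * q) ^ m)" for m
    proof -
      have "qexp_coeff q (Suc m) * z ^ Suc m - qexp_coeff q (Suc m) * (z * q) ^ Suc m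
          = (qexp_coeff q (Suc m) * (1 - q ^ Suc m)) * z ^ Suc m"
        by (simp add: algebra_simps)
      then show ?thesis unfolding qexp_coeff_Suc[OF assms] by (simp add: algebra_simps)
    qed
    ultimately have "(\<lambda>m. - z * (qexp_coeff q m * (z * q) ^ m)) sums (G z - G (z * q))"
      by simp
    moreover have "(\<lambda>m. - z * (qexp_coeff q m * (z * q) ^ m)) sums (- z * G (z * q))"
      by (intro sums_mult G)
    ultimately have "G z - G (z * q) = - z * G (z * q)" by (rule sums_unique2)
    then show ?thesis by (simp add: algebra_simps)
  qed
  have "(\<lambda>n. \<Sum>m. qexp_coeff q m * z ^ m * (q ^ n) ^ m) \<longlonglongrightarrow> qexp_coeff q 0 * z ^ 0"
    by (intro powser_contract_tendsto summable_norm_qexp assms)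
  then have "(\<lambda>n. G (z * q ^ n)) \<longlonglongrightarrow> 1"
    by (simp add: G_def power_mult_distrib mult.assoc)
  then have "(\<lambda>n. qpoch z q n * G (z * q ^ n)) \<longlonglongrightarrow> qpoch_inf z q * 1"
    by (intro tendsto_intros qpoch_tendsto assms)
  then have "G z = qpoch_inf z q"
    using qpoch_iterate[of G, OF rec] by (simp add: LIMSEQ_const_iff)
  then show ?thesis using G by metis
qed

section \<open>The q-binomial theorem\<close>

lemma summable_norm_qbinomial:
  assumes "norm q < 1" "norm z < 1"
  shows "summable (\<lambda>m. norm (qpoch a q m / qpoch q q m * z ^ m))"
proof (rule summable_norm_ratio_limit)
  show "qpoch a q (Suc m) / qpoch q q (Suc m) * z ^ Suc m
      = ((1 - a * q ^ m) / (1 - q * q ^ m) * z) * (qpoch a q m / qpoch q q m * z ^ m)" for m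
    by (simp add: qpoch_Suc mult_ac)
  have "(\<lambda>m. (1 - a * q ^ m) / (1 - q * q ^ m) * z) \<longlonglongrightarrow> 1 / 1 * z"
    by (intro tendsto_intros one_minus_power_tendsto assms) auto
  then show "(\<lambda>m. (1 - a * q ^ m) / (1 - q * q ^ m) * z) \<longlonglongrightarrow> z" by simp
qed (use assms in auto)

text \<open>Same method as for Euler's series: the recurrence of the coefficients yields
  \<open>(1 - x) * H x = (1 - a * x) * H (x * q)\<close> inside the unit disc, and iteration
  contracts the argument to 0.\<close>

theorem qbinomial_sums:
  assumes q: "norm q < 1" and z: "norm z < 1"
  shows "(\<lambda>m. qpoch a q m / qpoch q q m * z ^ m) sums (qpoch_inf (a * z) q / qpoch_inf z q)"
proof -
  define c where "c m = qpoch a q m / qpoch q q m" for m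
  define H where "H z = (\<Sum>m. c m * z ^ m)" for z
  have small: "norm (x * q) < 1" if "norm x < 1" for x
  proof -
    have "norm x * norm q \<le> norm x * 1" using q by (intro mult_left_mono) auto
    with that show ?thesis by (simp add: norm_mult)
  qed
  have H: "(\<lambda>m. c m * x ^ m) sums H x" if "norm x < 1" for x
    unfolding H_def c_def
    by (intro summable_sums summable_norm_cancel[OF summable_norm_qbinomial] q that)
  have c: "c (Suc m) * (1 - q ^ Suc m) = c m * (1 - a * q ^ m)" for m
    using one_minus_power_nonzero[OF q, of m] qpoch_q_nonzero[OF q, of m]
    by (simp add: c_def qpoch_Suc field_simps)
  have rec: "(1 - x) * H x = (1 - a * x) * H (x * q)" if x: "norm x < 1" for x
  proof -
    note x' = small[OF x]
    have "(\<lambda>m. c m * x ^ m - c m * (x * q) ^ m) sums (H x - H (x * q))"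
      by (intro sums_diff H x x')
    then have "(\<lambda>m. c (Suc m) * x ^ Suc m - c (Suc m) * (x * q) ^ Suc m) sums (H x - H (x * q))"
      by (subst sums_Suc_iff) simp
    moreover have "c (Suc m) * x ^ Suc m - c (Suc m) * (x * q) ^ Suc m
        = x * (c m * x ^ m) - a * x * (c m * (x * q) ^ m)" for m
    proof -
      have "c (Suc m) * x ^ Suc m - c (Suc m) * (x * q) ^ Suc m
          = (c (Suc m) * (1 - q ^ Suc m)) * x ^ Suc m"
        by (simp add: algebra_simps)
      then show ?thesis unfolding c by (simp add: algebra_simps)
    qed
    ultimately have "(\<lambda>m. x * (c m * x ^ m) - a * x * (c m * (x * q) ^ m))
        sums (H x - H (x * q))"
      by simp
    moreover have "(\<lambda>m. x * (c m * x ^ m) - a * x * (c m * (x * q) ^ m))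
        sums (x * H x - a * x * H (x * q))"
      by (intro sums_diff sums_mult H x x')
    ultimately have "H x - H (x * q) = x * H x - a * x * H (x * q)" by (rule sums_unique2)
    then show ?thesis by (simp add: algebra_simps)
  qed
  have small_pow: "norm (z * q ^ n) < 1" for n
    by (induction n) (use z small[of "z * q ^ n" for n] in \<open>simp_all add: mult_ac\<close>)
  \<comment> \<open>Stated without quotients; the division is made once, in the limit, where
    \<open>qpoch_inf z q\<close> is nonzero.\<close>
  have iter: "qpoch z q n * H z = qpoch (a * z) q n * H (z * q ^ n)" for n
  proof (induction n)
    case (Suc n)
    have "qpoch z q (Suc n) * H z = (1 - z * q ^ n) * (qpoch z q n * H z)"
      by (simp add: qpoch_Suc)
    also have "\<dots> = qpoch (a * z) q n * ((1 - z * q ^ n) * H (z * q ^ n))"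
      unfolding Suc by (simp only: mult_ac)
    also have "\<dots> = qpoch (a * z) q n * ((1 - a * (z * q ^ n)) * H (z * q ^ n * q))"
      unfolding rec[OF small_pow[of n]] ..
    finally show ?case by (simp add: qpoch_Suc mult_ac)
  qed simp
  have "(\<lambda>n. \<Sum>m. c m * z ^ m * (q ^ n) ^ m) \<longlonglongrightarrow> c 0 * z ^ 0"
    using summable_norm_qbinomial[OF q z] unfolding c_def
    by (intro powser_contract_tendsto q)
  then have "(\<lambda>n. H (z * q ^ n)) \<longlonglongrightarrow> 1"
    by (simp add: H_def c_def power_mult_distrib mult.assoc)
  then have "(\<lambda>n. qpoch (a * z) q n * H (z * q ^ n)) \<longlonglongrightarrow> qpoch_inf (a * z) q * 1"
    by (intro tendsto_intros qpoch_tendsto q)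
  moreover have "(\<lambda>n. qpoch z q n * H z) \<longlonglongrightarrow> qpoch_inf z q * H z"
    by (intro tendsto_intros qpoch_tendsto q)
  ultimately have "qpoch_inf z q * H z = qpoch_inf (a * z) q"
    unfolding iter using LIMSEQ_unique by fastforce
  moreover have "qpoch_inf z q \<noteq> 0"
    by (intro qpoch_inf_nonzero mult_power_neq_1 q z)
  ultimately have "H z = qpoch_inf (a * z) q / qpoch_inf z q" by (simp add: field_simps)
  then show ?thesis using H[OF z] by (simp add: c_def)
qed

section \<open>Partial fractions of a quotient of infinite products\<close>

lemma inverse_one_minus_power_tendsto:
  fixes a q :: complex
  assumes "norm q < 1"
  shows "(\<lambda>n. 1 / (1 - a * q ^ n)) \<longlonglongrightarrow> 1"
proof -
  have "(\<lambda>n. 1 / (1 - a * q ^ n)) \<longlonglongrightarrow> 1 / 1"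
    by (intro tendsto_intros one_minus_power_tendsto assms) auto
  then show ?thesis by simp
qed

text \<open>A convergent sequence is bounded, and a term with vanishing denominator has the value 0.
  The bound provides the majorants for the limit and the interchange of sums below.\<close>

lemma inverse_one_minus_power_bounded:
  fixes a q :: complex
  assumes "norm q < 1"
  obtains B where "B > 0" "\<And>n. norm (1 / (1 - a * q ^ n)) \<le> B"
proof -
  have "Bseq (\<lambda>n. 1 / (1 - a * q ^ n))"
    using inverse_one_minus_power_tendsto[OF assms, of a] convergentI convergent_imp_Bseq by blast
  then show ?thesis using that unfolding Bseq_def by blast
qed

text \<open>For \<open>q \<noteq> 0\<close> the right side, as a function of \<open>a\<close>, has
  simple poles at the inverse powers of \<open>q\<close>, and the series is its partial fraction
  expansion. The proof avoids residues: with \<open>a * q ^ n\<close> in place of \<open>a\<close>,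
  the series \<open>f n\<close> obeys the recurrence of \<open>qpoch a q n\<close>, and its limit is
  Euler's series at \<open>q\<close>.\<close>

theorem qexp_partial_fraction:
  assumes q: "norm q < 1" and a: "\<And>k. a * q ^ k \<noteq> 1"
  shows "(\<lambda>m. qexp_coeff q m * q ^ m / (1 - a * q ^ m)) sums (qpoch_inf q q / qpoch_inf a q)"
proof -
  define f where "f n = (\<Sum>m. qexp_coeff q m * q ^ m / (1 - a * q ^ (n + m)))" for n
  obtain B where B: "B > 0" "\<And>n. norm (1 / (1 - a * q ^ n)) \<le> B"
    using inverse_one_minus_power_bounded[OF q] by blast
  have bound: "norm (qexp_coeff q m * q ^ m / (1 - a * q ^ (n + m)))
      \<le> B * norm (qexp_coeff q m * q ^ m)" for n m
    using mult_left_mono[OF B(2)[of "n + m"], of "norm (qexp_coeff q m * q ^ m)"]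
    by (simp add: norm_divide mult_ac)
  have summB: "summable (\<lambda>m. B * norm (qexp_coeff q m * q ^ m))"
    by (intro summable_mult summable_norm_qexp q)
  have f: "(\<lambda>m. qexp_coeff q m * q ^ m / (1 - a * q ^ (n + m))) sums f n" for n
    unfolding f_def
    by (intro summable_sums summable_norm_cancel[OF summable_comparison_test'[OF summB, of 0]])
      (use bound in auto)
  have nz: "1 - a * q ^ n \<noteq> 0" for n using a[of n] by simp
  have rec: "f (Suc n) = (1 - a * q ^ n) * f n" for n
  proof -
    have "(\<lambda>m. qexp_coeff q (Suc m) * q ^ Suc m / (1 - a * q ^ (n + Suc m)))
        sums (f n - 1 / (1 - a * q ^ n))"
      using f[of n] by (subst sums_Suc_iff) simp
    then have "(\<lambda>m. (1 - a * q ^ n) * (qexp_coeff q (Suc m) * q ^ Suc m / (1 - a * q ^ (n + Suc m)))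
          - qexp_coeff q m * q ^ m / (1 - a * q ^ (Suc n + m)))
        sums ((1 - a * q ^ n) * (f n - 1 / (1 - a * q ^ n)) - f (Suc n))"
      by (intro sums_diff sums_mult f)
    \<comment> \<open>The shift by one index makes both denominators equal to \<open>D\<close>. By
      the recurrence of the coefficients the combined numerator is a multiple of \<open>D\<close>,
      so only a bare Euler coefficient remains.\<close>
    moreover have "(1 - a * q ^ n) * (qexp_coeff q (Suc m) * q ^ Suc m / (1 - a * q ^ (n + Suc m)))
          - qexp_coeff q m * q ^ m / (1 - a * q ^ (Suc n + m)) = qexp_coeff q (Suc m)" for m
    proof -
      define D where "D = 1 - a * q ^ (Suc n + m)"
      have D: "D \<noteq> 0" unfolding D_def by (rule nz)
      have *: "qexp_coeff q m * q ^ m = - (qexp_coeff q (Suc m) * (1 - q ^ Suc m))"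
        unfolding qexp_coeff_Suc[OF q] by simp
      have "(1 - a * q ^ n) * (qexp_coeff q (Suc m) * q ^ Suc m) - qexp_coeff q m * q ^ m
          = qexp_coeff q (Suc m) * D"
        unfolding * D_def by (simp add: algebra_simps power_add)
      then have "((1 - a * q ^ n) * (qexp_coeff q (Suc m) * q ^ Suc m) - qexp_coeff q m * q ^ m) / D
          = qexp_coeff q (Suc m)"
        using D by simp
      then show ?thesis
        unfolding D_def add_Suc_right add_Suc[symmetric]
        by (simp only: diff_divide_distrib times_divide_eq_right add_Suc)
    qed
    ultimately have "(\<lambda>m. qexp_coeff q (Suc m))
        sums ((1 - a * q ^ n) * (f n - 1 / (1 - a * q ^ n)) - f (Suc n))"
      by simp
    \<comment> \<open>Euler's product at 1 contains the factor \<open>1 - 1\<close>, so the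
      coefficients from index 1 on add up to -1. This cancels the contribution of the split-off term
      of index 0.\<close>
    moreover have "(\<lambda>m. qexp_coeff q (Suc m)) sums (qpoch_inf 1 q - 1)"
      using qexp_sums[OF q, of 1] by (subst sums_Suc_iff) simp
    moreover have "qpoch_inf 1 q = 0"
      using qpoch_inf_shift[OF q, of 1] by simp
    ultimately have "(1 - a * q ^ n) * (f n - 1 / (1 - a * q ^ n)) - f (Suc n) = - 1"
      using sums_unique2 by force
    then show ?thesis using nz[of n] by (simp add: algebra_simps)
  qed
  have iter: "f n = qpoch a q n * f 0" for n
    by (induction n) (simp_all add: rec qpoch_Suc)
  have "f \<longlonglongrightarrow> (\<Sum>m. qexp_coeff q m * q ^ m)"
    unfolding f_def
  proof (rule tannerys_theorem[THEN conjunct2, THEN conjunct2])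
    show "(\<lambda>n. qexp_coeff q m * q ^ m / (1 - a * q ^ (n + m))) \<longlonglongrightarrow> qexp_coeff q m * q ^ m" for m
      using tendsto_mult_left[OF LIMSEQ_ignore_initial_segment[OF
          inverse_one_minus_power_tendsto[OF q, of a], of m], of "qexp_coeff q m * q ^ m"]
      by simp
    show "\<forall>\<^sub>F (m, n) in at_top \<times>\<^sub>F sequentially.
        norm (qexp_coeff q m * q ^ m / (1 - a * q ^ (n + m))) \<le> B * norm (qexp_coeff q m * q ^ m)"
      using bound by (intro always_eventually) auto
  qed (use summB in auto)
  then have "f \<longlonglongrightarrow> qpoch_inf q q"
    using qexp_sums[OF q, of q] by (simp add: sums_iff)
  moreover have "(\<lambda>n. qpoch a q n * f 0) \<longlonglongrightarrow> qpoch_inf a q * f 0"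
    by (intro tendsto_intros qpoch_tendsto q)
  then have "f \<longlonglongrightarrow> qpoch_inf a q * f 0" unfolding iter[symmetric] .
  ultimately have "qpoch_inf a q * f 0 = qpoch_inf q q" using LIMSEQ_unique by blast
  moreover have "qpoch_inf a q \<noteq> 0" by (intro qpoch_inf_nonzero q a)
  ultimately have "f 0 = qpoch_inf q q / qpoch_inf a q" by (simp add: field_simps)
  then show ?thesis using f[of 0] by simp
qed

section \<open>The q-Vandermonde sum\<close>

text \<open>The terminating sum 2phi1(q^(-k), y; yb; q, q) written as a convolution:
  \<open>qexp_coeff q (k - n)\<close> absorbs (q^(-k);q)_n, so no negative power of \<open>q\<close>
  occurs. The lower parameter d is written \<open>y * b\<close>, so that d/b becomes
  \<open>y\<close>.\<close>

lemma q_Vandermonde: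
  assumes q: "norm q < 1" and "\<And>k. y * b * q ^ k \<noteq> 1"
  shows "(\<Sum>n\<le>k. (qpoch y q n / (qpoch q q n * qpoch (y * b) q n) * q ^ n)
             * (qexp_coeff q (k - n) * q ^ (k - n)))
       = qexp_coeff q k * (q * y) ^ k * qpoch b q k / qpoch (y * b) q k"
  using assms(2)
\<comment> \<open>\<open>y\<close> is generalised because the induction step also uses the sum with
  parameter \<open>y * q\<close>.\<close>
proof (induction k arbitrary: y)
  case 0
  then show ?case by simp
next
  case (Suc k)
  define v where "v x n = qpoch x q n / (qpoch q q n * qpoch (x * b) q n) * q ^ n" for x n
  define w where "w m = qexp_coeff q m * q ^ m" for m
  have yb: "y * b * q ^ n \<noteq> 1" for n by (rule Suc.prems)
  then have yb1: "1 - y * b \<noteq> 0" using yb[of 0] by simp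
  have yqb: "y * q * b * q ^ n \<noteq> 1" for n using yb[of "Suc n"] by (simp add: mult_ac)
  have IH: "(\<Sum>n\<le>k. v x n * w (k - n))
      = qexp_coeff q k * (q * x) ^ k * qpoch b q k / qpoch (x * b) q k"
    if "\<And>n. x * b * q ^ n \<noteq> 1" for x
    using Suc.IH[OF that] unfolding v_def w_def .
  have nzq: "1 - q ^ Suc n \<noteq> 0" for n by (rule one_minus_power_nonzero[OF q])
  have v_Suc: "v y (Suc n) * (1 - q ^ Suc n) = q * (1 - y) / (1 - y * b) * v (y * q) n" for n
  proof -
    have "qpoch y q (Suc n) = (1 - y) * qpoch (y * q) q n"
      "qpoch (y * b) q (Suc n) = (1 - y * b) * qpoch (y * q * b) q n"
      "qpoch q q (Suc n) = qpoch q q n * (1 - q ^ Suc n)"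
      by (simp only: qpoch_Suc_shift, simp only: qpoch_Suc_shift mult_ac, simp add: qpoch_Suc)
    then show ?thesis unfolding v_def using nzq[of n] by (simp add: mult_ac)
  qed
  have w_Suc: "w (Suc m) * (1 - q ^ Suc m) = - (q ^ Suc m) * w m" for m
  proof -
    have "w (Suc m) * (1 - q ^ Suc m) = (qexp_coeff q (Suc m) * (1 - q ^ Suc m)) * q ^ Suc m"
      by (simp only: w_def mult_ac)
    then show ?thesis unfolding qexp_coeff_Suc[OF q] by (simp add: w_def)
  qed
  \<comment> \<open>The Pascal-type splitting $1 - q^{k+1} = (1 - q^n) + q^n (1 - q^{k+1-n})$ turns the sum
    into the same sums of length $k$ with parameters $yq$ and $y$.\<close>
  have "(1 - q ^ Suc k) * (\<Sum>n\<le>Suc k. v y n * w (Suc k - n))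
      = (\<Sum>n\<le>Suc k. v y n * (1 - q ^ n) * w (Suc k - n))
        + (\<Sum>n\<le>Suc k. v y n * (q ^ n * (1 - q ^ (Suc k - n)) * w (Suc k - n)))"
    unfolding sum_distrib_left sum.distrib[symmetric]
  proof (rule sum.cong[OF refl])
    fix n assume "n \<in> {..Suc k}"
    then have "q ^ Suc k = q ^ n * q ^ (Suc k - n)" by (simp flip: power_add)
    then show "(1 - q ^ Suc k) * (v y n * w (Suc k - n)) = v y n * (1 - q ^ n) * w (Suc k - n)
        + v y n * (q ^ n * (1 - q ^ (Suc k - n)) * w (Suc k - n))"
      by (simp only:) (simp add: algebra_simps)
  qed
  \<comment> \<open>The factor \<open>1 - q ^ n\<close> removes the term \<open>n = 0\<close>; in
    the others \<open>v_Suc\<close> lowers the index and moves \<open>y\<close> to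
    \<open>y * q\<close>.\<close>
  also have "(\<Sum>n\<le>Suc k. v y n * (1 - q ^ n) * w (Suc k - n))
      = q * (1 - y) / (1 - y * b) * (\<Sum>n\<le>k. v (y * q) n * w (k - n))"
    by (subst sum.atMost_Suc_shift) (simp only: v_Suc sum_distrib_left power_0 diff_self, simp add: mult_ac)
  \<comment> \<open>Here the factor vanishes at the top index \<open>n = Suc k\<close>, and
    \<open>w_Suc\<close> lowers the index of \<open>w\<close> in the remaining terms.\<close>
  also have "(\<Sum>n\<le>Suc k. v y n * (q ^ n * (1 - q ^ (Suc k - n)) * w (Suc k - n)))
      = - (q ^ Suc k) * (\<Sum>n\<le>k. v y n * w (k - n))"
    unfolding sum.atMost_Suc sum_distrib_left
  proof -
    have "v y n * (q ^ n * (1 - q ^ (Suc k - n)) * w (Suc k - n)) = - (q ^ Suc k) * (v y n * w (k - n))"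
      if "n \<in> {..k}" for n
    proof -
      have *: "Suc k - n = Suc (k - n)" and **: "q ^ Suc k = q ^ n * q ^ Suc (k - n)"
        using that by (auto simp flip: power_add)
      have "v y n * (q ^ n * (1 - q ^ (Suc k - n)) * w (Suc k - n))
          = v y n * q ^ n * (w (Suc (k - n)) * (1 - q ^ Suc (k - n)))"
        unfolding * by (simp only: mult_ac)
      then show ?thesis unfolding w_Suc ** by (simp only: mult_ac mult_minus_left mult_minus_right)
    qed
    then have "(\<Sum>n\<le>k. v y n * (q ^ n * (1 - q ^ (Suc k - n)) * w (Suc k - n)))
        = (\<Sum>n\<le>k. - (q ^ Suc k) * (v y n * w (k - n)))"
      by (rule sum.cong[OF refl])
    then show "(\<Sum>n\<le>k. v y n * (q ^ n * (1 - q ^ (Suc k - n)) * w (Suc k - n)))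
        + v y (Suc k) * (q ^ Suc k * (1 - q ^ (Suc k - Suc k)) * w (Suc k - Suc k))
        = (\<Sum>n\<le>k. - (q ^ Suc k) * (v y n * w (k - n)))"
      by simp
  qed
  also have "(\<Sum>n\<le>k. v (y * q) n * w (k - n))
      = qexp_coeff q k * (q * (y * q)) ^ k * qpoch b q k / qpoch (y * q * b) q k"
    by (rule IH) (rule yqb)
  also have "(\<Sum>n\<le>k. v y n * w (k - n))
      = qexp_coeff q k * (q * y) ^ k * qpoch b q k / qpoch (y * b) q k"
    by (rule IH) (rule yb)
  finally have main: "(1 - q ^ Suc k) * (\<Sum>n\<le>Suc k. v y n * w (Suc k - n))
      = q * (1 - y) / (1 - y * b)
          * (qexp_coeff q k * (q * (y * q)) ^ k * qpoch b q k / qpoch (y * q * b) q k)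
        + - (q ^ Suc k) * (qexp_coeff q k * (q * y) ^ k * qpoch b q k / qpoch (y * b) q k)" .
  \<comment> \<open>The common factor of the two sums of length \<open>k\<close>, put over the
    denominator needed at \<open>Suc k\<close>.\<close>
  define E where "E = qexp_coeff q k * (q * y) ^ k * qpoch b q k / qpoch (y * b) q (Suc k)"
  have nz1: "1 - y * b * q ^ k \<noteq> 0" using yb[of k] by simp
  have "qpoch (y * b) q (Suc k) = (1 - y * b) * qpoch (y * q * b) q k"
    by (simp only: qpoch_Suc_shift mult_ac)
  then have "q * (1 - y) / (1 - y * b)
          * (qexp_coeff q k * (q * (y * q)) ^ k * qpoch b q k / qpoch (y * q * b) q k)
      = q ^ Suc k * (1 - y) * E"
    by (simp add: E_def power_mult_distrib mult_ac)
  moreover have "qexp_coeff q k * (q * y) ^ k * qpoch b q k / qpoch (y * b) q k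
      = (1 - y * b * q ^ k) * E"
    using nz1 by (simp add: E_def qpoch_Suc)
  ultimately have "(1 - q ^ Suc k) * (\<Sum>n\<le>Suc k. v y n * w (Suc k - n))
      = q ^ Suc k * (1 - y) * E + - (q ^ Suc k) * ((1 - y * b * q ^ k) * E)"
    using main by simp
  \<comment> \<open>Since (1 - y) - (1 - y b q^k) = -y (1 - b q^k), the new factor of
    \<open>qpoch b q (Suc k)\<close> appears, and \<open>- (q ^ k)\<close> is the factor in
    \<open>qexp_coeff_Suc\<close>.\<close>
  also have "\<dots> = - (q ^ k) * (q * y) * (1 - b * q ^ k) * E"
    by (simp add: algebra_simps)
  also have "\<dots> = (1 - q ^ Suc k)
      * (qexp_coeff q (Suc k) * (q * y) ^ Suc k * qpoch b q (Suc k) / qpoch (y * b) q (Suc k))"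
  proof -
    have "(1 - q ^ Suc k)
      * (qexp_coeff q (Suc k) * (q * y) ^ Suc k * qpoch b q (Suc k) / qpoch (y * b) q (Suc k))
      = (qexp_coeff q (Suc k) * (1 - q ^ Suc k))
        * ((q * y) ^ Suc k * qpoch b q (Suc k) / qpoch (y * b) q (Suc k))"
      by (simp only: mult_ac times_divide_eq_right times_divide_eq_left)
    then show ?thesis
      unfolding qexp_coeff_Suc[OF q] E_def by (simp add: qpoch_Suc[of b] mult_ac)
  qed
  finally show ?case unfolding mult_left_cancel[OF nzq[of k]] v_def w_def .
qed

section \<open>Interchange of sums and the transformation of q-series\<close>

text \<open>A Cauchy product with a weight that is constant on each antidiagonal
  \<open>n + m = k\<close>. As \<open>g\<close> is bounded, the double series is dominated by
  \<open>norm (v n) * norm (w m) * B\<close>, so it may be summed by rows or by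
  antidiagonals.\<close>

lemma weighted_Cauchy_product_sums:
  fixes v w g :: "nat \<Rightarrow> complex"
  assumes v: "summable (\<lambda>n. norm (v n))" and w: "summable (\<lambda>n. norm (w n))"
    and g: "\<And>k. norm (g k) \<le> B"
    and F: "\<And>n. (\<lambda>m. w m * g (n + m)) sums F n"
    and S: "(\<lambda>n. v n * F n) sums S"
  shows "(\<lambda>k. g k * (\<Sum>n\<le>k. v n * w (k - n))) sums S"
proof -
  define f where "f = (\<lambda>(n, m). v n * (w m * g (n + m)))"
  define W where "W = (\<Sum>m. norm (w m) * B)"
  have "B \<ge> 0" using order_trans[OF norm_ge_zero g] .
  have hs: "((\<lambda>m. norm (v n) * (norm (w m) * B)) has_sum norm (v n) * W) UNIV" for n
    unfolding W_def using w \<open>B \<ge> 0\<close>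
    by (intro has_sum_cmult_right norm_summable_imp_has_sum summable_sums summable_mult2)
      (auto simp: norm_mult intro: summable_mult2)
  have "(\<lambda>(n, m). norm (v n) * (norm (w m) * B)) summable_on (UNIV \<times> UNIV)"
  proof (rule summable_on_SigmaI)
    show "((\<lambda>m. case (n, m) of (n, m) \<Rightarrow> norm (v n) * (norm (w m) * B)) has_sum norm (v n) * W) UNIV"
      for n using hs by simp
    show "(\<lambda>n. norm (v n) * W) summable_on UNIV"
      using v by (intro summable_on_cmult_left norm_summable_imp_summable_on) auto
  qed (use \<open>B \<ge> 0\<close> in auto)
  then have "(\<lambda>p. norm (f p)) summable_on (UNIV \<times> UNIV)"
  proof (rule Infinite_Sum.abs_summable_on_comparison_test')
    show "norm (f p) \<le> (case p of (n, m) \<Rightarrow> norm (v n) * (norm (w m) * B))" for p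
      using g by (auto simp: f_def norm_mult intro!: mult_left_mono split: prod.splits)
  qed
  then have "f summable_on (UNIV \<times> UNIV)" by (rule abs_summable_summable)
  then obtain S' where S': "(f has_sum S') (UNIV \<times> UNIV)" by (auto simp: summable_on_def)
  have inner: "((\<lambda>m. f (n, m)) has_sum v n * F n) UNIV" for n
  proof -
    have "summable (\<lambda>m. norm (w m) * B)" using w by (rule summable_mult2)
    then have "summable (\<lambda>m. norm (w m * g (n + m)))"
      by (rule summable_comparison_test'[where N = 0])
        (use g in \<open>auto simp: norm_mult intro!: mult_left_mono\<close>)
    then show ?thesis
      unfolding f_def using F[of n]
      by (auto intro!: has_sum_cmult_right norm_summable_imp_has_sum)
  qed
  have "((\<lambda>n. v n * F n) has_sum S') UNIV"
    by (rule has_sum_SigmaD[OF S']) (use inner in auto)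
  then have "S' = S" using S has_sum_imp_sums sums_unique2 by blast
  \<comment> \<open>The map from \<open>(n, m)\<close> to \<open>(n + m, n)\<close> turns the
    quadrant into the triangle \<open>n \<le> k\<close>, whose rows are the antidiagonals.\<close>
  have "((\<lambda>(k, n). v n * (w (k - n) * g k)) has_sum S) (SIGMA k:UNIV. {..k})"
    using S' unfolding \<open>S' = S\<close>
    by (subst has_sum_reindex_bij_witness[where T = "UNIV \<times> UNIV" and h = f and s' = S
          and j = "\<lambda>(k, n). (n, k - n)" and i = "\<lambda>(n, m). (n + m, n)"]) (auto simp: f_def)
  then have "((\<lambda>k. \<Sum>n\<le>k. v n * (w (k - n) * g k)) has_sum S) UNIV"
    by (rule has_sum_SigmaD) (auto intro!: has_sum_finite)
  then have "(\<lambda>k. \<Sum>n\<le>k. v n * (w (k - n) * g k)) sums S" by (rule has_sum_imp_sums)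
  then show ?thesis by (simp add: sum_distrib_left mult_ac)
qed

lemma summable_norm_qpoch_quotient:
  assumes q: "norm q < 1"
  shows "summable (\<lambda>n. norm (qpoch a q n * qpoch y q n / (qpoch q q n * qpoch d q n) * q ^ n))"
proof (rule summable_norm_ratio_limit)
  show "qpoch a q (Suc n) * qpoch y q (Suc n) / (qpoch q q (Suc n) * qpoch d q (Suc n)) * q ^ Suc n
      = ((1 - a * q ^ n) * (1 - y * q ^ n) / ((1 - q * q ^ n) * (1 - d * q ^ n)) * q)
        * (qpoch a q n * qpoch y q n / (qpoch q q n * qpoch d q n) * q ^ n)" for n
    by (simp add: qpoch_Suc mult_ac)
  have "(\<lambda>n. (1 - a * q ^ n) * (1 - y * q ^ n) / ((1 - q * q ^ n) * (1 - d * q ^ n)) * q)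
      \<longlonglongrightarrow> 1 * 1 / (1 * 1) * q"
    by (intro tendsto_intros one_minus_power_tendsto q) auto
  then show "(\<lambda>n. (1 - a * q ^ n) * (1 - y * q ^ n) / ((1 - q * q ^ n) * (1 - d * q ^ n)) * q)
      \<longlonglongrightarrow> q" by simp
qed (rule q)

text \<open>The q-Vandermonde sum expands each term on the left as a convolution, weighted by
  \<open>1 / (1 - a * q ^ k)\<close>. After the interchange the inner sum is the partial fraction
  series at \<open>a * q ^ n\<close>, which contributes the factor \<open>qpoch a q n\<close>. The
  weight stands for (a;q)_k/(aq;q)_k up to the constant \<open>1 - a\<close>.\<close>

theorem qhyper_transformation:
  assumes q: "norm q < 1" and a: "\<And>k. a * q ^ k \<noteq> 1" and d: "\<And>k. y * b * q ^ k \<noteq> 1"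
    and S: "(\<lambda>n. qpoch a q n * qpoch y q n / (qpoch q q n * qpoch (y * b) q n) * q ^ n) sums S"
  shows "(\<lambda>k. qexp_coeff q k * (q * y) ^ k * qpoch b q k / qpoch (y * b) q k / (1 - a * q ^ k))
    sums (qpoch_inf q q / qpoch_inf a q * S)"
proof -
  define v where "v n = qpoch y q n / (qpoch q q n * qpoch (y * b) q n) * q ^ n" for n
  define w where "w m = qexp_coeff q m * q ^ m" for m
  define g where "g k = 1 / (1 - a * q ^ k)" for k
  define F where "F n = qpoch_inf q q / qpoch_inf (a * q ^ n) q" for n
  obtain B where B: "\<And>n. norm (g n) \<le> B"
    using inverse_one_minus_power_bounded[OF q] unfolding g_def by blast
  have "summable (\<lambda>n. norm (v n))"
    \<comment> \<open>With first parameter 0 the corresponding symbol is identically 1.\<close>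
    using summable_norm_qpoch_quotient[OF q, of 0 y "y * b"]
    by (simp add: v_def qpoch_def)
  moreover have "summable (\<lambda>m. norm (w m))"
    unfolding w_def by (rule summable_norm_qexp[OF q])
  moreover have "(\<lambda>m. w m * g (n + m)) sums F n" for n
  proof -
    have "a * q ^ n * q ^ k \<noteq> 1" for k
      using a[of "n + k"] by (simp add: power_add mult_ac)
    from qexp_partial_fraction[OF q this] show ?thesis
      by (simp add: w_def g_def F_def power_add mult_ac)
  qed
  moreover have "(\<lambda>n. v n * F n) sums (qpoch_inf q q / qpoch_inf a q * S)"
  proof -
    have "v n * F n = qpoch_inf q q / qpoch_inf a q
        * (qpoch a q n * qpoch y q n / (qpoch q q n * qpoch (y * b) q n) * q ^ n)" for n
    proof -
      have "qpoch_inf a q = qpoch a q n * qpoch_inf (a * q ^ n) q"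
        by (rule qpoch_iterate[where G = "\<lambda>z. qpoch_inf z q"]) (rule qpoch_inf_shift[OF q])
      moreover have "qpoch a q n \<noteq> 0" by (rule qpoch_nonzero) (rule a)
      ultimately have "F n = qpoch_inf q q / qpoch_inf a q * qpoch a q n"
        by (simp add: F_def)
      then show ?thesis by (simp add: v_def mult_ac)
    qed
    then show ?thesis by (simp only: sums_mult[OF S])
  qed
  ultimately have "(\<lambda>k. g k * (\<Sum>n\<le>k. v n * w (k - n))) sums (qpoch_inf q q / qpoch_inf a q * S)"
    by (intro weighted_Cauchy_product_sums[where B = B] B)
  moreover have "(\<Sum>n\<le>k. v n * w (k - n))
      = qexp_coeff q k * (q * y) ^ k * qpoch b q k / qpoch (y * b) q k" for k
    unfolding v_def w_def by (rule q_Vandermonde[OF q d])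
  ultimately show ?thesis by (simp add: g_def mult_ac)
qed

section \<open>Even and odd parts of a q-binomial series\<close>

text \<open>The q-binomial theorem with \<open>a = -1\<close> gives \<open>R\<close> at
  \<open>z = q\<close> and \<open>1 / R\<close> at \<open>z = -q\<close>. Half the sum and half the
  difference isolate the even and the odd terms.\<close>

lemma qpoch_minus_1_quotient_sums:
  fixes q :: complex
  assumes q: "norm q < 1"
  defines "R \<equiv> qpoch_inf (-q) q / qpoch_inf q q"
  shows "(\<lambda>n. qpoch (-1) q (2 * n) / qpoch q q (2 * n) * q ^ (2 * n)) sums ((R + 1 / R) / 2)"
    and "(\<lambda>n. qpoch (-1) q (2 * n + 1) / qpoch q q (2 * n + 1) * q ^ (2 * n + 1))
      sums ((R - 1 / R) / 2)"
proof -
  define c where "c m = qpoch (-1) q m / qpoch q q m" for m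
  have plus: "(\<lambda>m. c m * q ^ m) sums R"
    using qbinomial_sums[OF q q, of "-1"] by (simp add: c_def R_def)
  have minus: "(\<lambda>m. c m * (-q) ^ m) sums (1 / R)"
    using qbinomial_sums[OF q, of "-q" "-1"] q by (simp add: c_def R_def)
  have block: "{n * 2..<n * 2 + 2} = {2 * n, 2 * n + 1}" for n :: nat by auto
  \<comment> \<open>Grouping indices in pairs leaves one nonzero contribution per block, here the
    even one.\<close>
  have "(\<lambda>n. \<Sum>m\<in>{n * 2..<n * 2 + 2}. (c m * q ^ m + c m * (-q) ^ m) / 2) sums ((R + 1 / R) / 2)"
    by (intro sums_group sums_divide sums_add plus minus) simp
  then show "(\<lambda>n. qpoch (-1) q (2 * n) / qpoch q q (2 * n) * q ^ (2 * n)) sums ((R + 1 / R) / 2)"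
    unfolding block by (simp add: c_def mult_ac)
  have "(\<lambda>n. \<Sum>m\<in>{n * 2..<n * 2 + 2}. (c m * q ^ m - c m * (-q) ^ m) / 2) sums ((R - 1 / R) / 2)"
    by (intro sums_group sums_divide sums_diff plus minus) simp
  then show "(\<lambda>n. qpoch (-1) q (2 * n + 1) / qpoch q q (2 * n + 1) * q ^ (2 * n + 1))
      sums ((R - 1 / R) / 2)"
    unfolding block by (simp add: c_def mult_ac)
qed

text \<open>Source of the quadratic exponents: in base \<open>q^2\<close> the Euler coefficient
  carries \<open>q ^ (k * (k - 1))\<close>, to which \<open>(q^2) ^ k\<close> adds
  \<open>2 * k\<close>. The signs cancel because the transformation is used with negative
  \<open>y = -x\<close>.\<close>

lemma qexp_coeff_square_power:
  "qexp_coeff (q^2) k * (q^2 * - x) ^ k = q ^ (k^2 + k) * x ^ k / qpoch (q^2) (q^2) k"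
proof -
  have "2 * (k * (k - 1) div 2) = k * (k - 1)"
    by (cases k) auto
  then have "(q^2) ^ (k * (k - 1) div 2) = q ^ (k * (k - 1))"
    by (metis power_mult)
  moreover have "(q^2 * - x) ^ k = (-1) ^ k * (q ^ (2 * k) * x ^ k)"
    by (simp add: power_mult_distrib power_mult power_minus[of x] power_minus[of "q^2 * x"])
  moreover have "k * (k - 1) + 2 * k = k^2 + k"
    by (cases k) (simp_all add: power2_eq_square)
  then have "q ^ (k * (k - 1)) * q ^ (2 * k) = q ^ (k^2 + k)"
    by (metis power_add)
  moreover have "(-1) ^ k * ((-1) ^ k :: complex) = 1"
    by (simp flip: power_mult_distrib)
  ultimately show ?thesis
    unfolding qexp_coeff_def by (simp add: field_simps)
qed

section \<open>The four identities\<close>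

theorem theorem1p4:
  fixes q :: complex
  assumes "norm q < 1"
  shows
   "((\<lambda>k. q ^ (k^2) * qpoch (-1) q (2*k) * qpoch (-1) (q^2) k / qpoch (q^2) (q^2) (2*k))
      sums ((3 * qpoch_inf (q^2) (q^2) ^ 3 / (qpoch_inf q q ^ 2 * qpoch_inf (q^4) (q^4))
             - qpoch_inf q q ^ 2 * qpoch_inf (q^2) (q^2) / qpoch_inf (q^4) (q^4)) / 2)) \<and>
    ((\<lambda>k. q ^ (k^2 + 2*k) * qpoch (-1) q (2*k) * qpoch (-1) (q^2) k / qpoch (q^2) (q^2) (2*k))
      sums ((qpoch_inf (q^2) (q^2) ^ 3 / (qpoch_inf q q ^ 2 * qpoch_inf (q^4) (q^4))
             + qpoch_inf q q ^ 2 * qpoch_inf (q^2) (q^2) / qpoch_inf (q^4) (q^4)) / 2)) \<and>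
    ((\<lambda>k. q ^ (k^2 + k) * qpoch (-1) q (2*k+1) * qpoch (-q) (q^2) k / qpoch (q^2) (q^2) (2*k+1))
      sums ((3 * qpoch_inf (q^4) (q^4) / qpoch_inf q q
             + qpoch_inf q q ^ 3 * qpoch_inf (q^4) (q^4) / qpoch_inf (q^2) (q^2) ^ 2) / 2)) \<and>
    ((\<lambda>k. q ^ (k^2 + 3*k + 1) * qpoch (-1) q (2*k+1) * qpoch (-q) (q^2) k / qpoch (q^2) (q^2) (2*k+1))
      sums ((qpoch_inf (q^4) (q^4) / qpoch_inf q q
             - qpoch_inf q q ^ 3 * qpoch_inf (q^4) (q^4) / qpoch_inf (q^2) (q^2) ^ 2) / 2))"
proof -
  define Q where "Q = q^2"
  \<comment> \<open>The base-\<open>Q\<close> factors that arise when \<open>qpoch (-1) q\<close>,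
    \<open>qpoch q q\<close> and \<open>qpoch (-q) q\<close> are split by the parity of the
    exponent. \<open>C\<close> and \<open>D'\<close> are \<open>A\<close> and \<open>D\<close>
    without their first factors 2 and \<open>1 - q\<close>, up to an index shift.\<close>
  define A B C D D' F where
    "A = qpoch (-1) Q" and "B = qpoch (-q) Q" and "C = qpoch (-Q) Q" and
    "D = qpoch q Q" and "D' = qpoch (q^3) Q" and "F = qpoch Q Q"
  note defs = A_def B_def C_def D_def D'_def F_def
  have q: "norm q < 1" by fact
  have Q: "norm Q < 1" unfolding Q_def by (rule norm_power2_less_1[OF q])
  have q3: "norm (q^3) < 1" using q by (simp add: norm_power power_less_one_iff)
  have q4: "norm (q^4) < 1" using q by (simp add: norm_power power_less_one_iff)
  have ne1: "x * Q ^ k \<noteq> 1" if "norm x < 1" for x k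
    by (intro mult_power_neq_1 Q that)
  have neA: "-1 * Q ^ k \<noteq> 1" for k
  proof (cases k)
    case (Suc n)
    then show ?thesis using ne1[of "-Q" n] Q by simp
  qed simp
  have q_power: "1 + q * Q ^ k \<noteq> 0" "1 - q * Q ^ k \<noteq> 0" "1 + Q * Q ^ k \<noteq> 0"
      "1 - Q * Q ^ k \<noteq> 0" "1 + Q ^ k \<noteq> 0" for k
    using ne1[of "-q" k] ne1[of q k] ne1[of "-Q" k] ne1[of Q k] neA[of k] q Q
    by (auto simp: add_eq_0_iff)
  have q1: "1 - q \<noteq> 0" using q by auto
  have nz: "A k \<noteq> 0" "B k \<noteq> 0" "C k \<noteq> 0" "D k \<noteq> 0" "D' k \<noteq> 0" "F k \<noteq> 0" for k
    unfolding defs by (intro qpoch_nonzero neA ne1; use q Q q3 in simp)+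
  have A_Suc: "A (Suc k) = 2 * C k" and AC: "A k * (1 + Q ^ k) = 2 * C k" for k
  proof -
    show "A (Suc k) = 2 * C k" unfolding defs qpoch_Suc_shift by simp
    then show "A k * (1 + Q ^ k) = 2 * C k" unfolding defs qpoch_Suc by simp
  qed
  have B_Suc: "B (Suc k) = B k * (1 + q * Q ^ k)" and C_Suc: "C (Suc k) = C k * (1 + Q * Q ^ k)"
    and D_Suc: "D (Suc k) = D k * (1 - q * Q ^ k)" and F_Suc: "F (Suc k) = F k * (1 - Q * Q ^ k)"
    for k by (simp_all add: defs qpoch_Suc)
  have D_shift: "D (Suc k) = (1 - q) * D' k" for k
    by (simp add: defs qpoch_Suc_shift Q_def power3_eq_cube power2_eq_square mult_ac)
  have m1_even: "qpoch (-1) q (2 * k) = A k * B k" and m1_odd: "qpoch (-1) q (2 * k + 1) = A (Suc k) * B k"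
    and q_even: "qpoch q q (2 * k) = D k * F k" and q_odd: "qpoch q q (2 * k + 1) = D (Suc k) * F k"
    and mq_even: "qpoch (-q) q (2 * k) = B k * C k"
    and mq_odd: "qpoch (-q) q (2 * k + 1) = B (Suc k) * C k" for k
    unfolding qpoch_double qpoch_double_Suc defs Q_def by (simp_all add: power2_eq_square)
  \<comment> \<open>(q^2;q^2)_m is the product of (q;q)_m and (-q;q)_m, each then split by
    parity.\<close>
  have Q_even: "qpoch Q Q (2 * k) = D k * F k * B k * C k"
    and Q_odd: "qpoch Q Q (2 * k + 1) = D (Suc k) * F k * B (Suc k) * C k" for k
    using qpoch_mult_minus[of q q "2 * k"] qpoch_mult_minus[of q q "2 * k + 1"]
    unfolding q_even q_odd mq_even mq_odd Q_def[symmetric] by (simp_all add: mult_ac)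

  \<comment> \<open>Infinite products in terms of \<open>E1\<close>, \<open>E2\<close>,
    \<open>E4\<close>\<close>
  define E1 E2 E4 where "E1 = qpoch_inf q q" and "E2 = qpoch_inf Q Q" and "E4 = qpoch_inf (q^4) (q^4)"
  have E: "E1 \<noteq> 0" "E2 \<noteq> 0" "E4 \<noteq> 0"
    unfolding E1_def E2_def E4_def by (intro qpoch_inf_nonzero mult_power_neq_1 q Q q4)+
  have inf_mq: "qpoch_inf (-q) q = E2 / E1"
    using qpoch_inf_mult_minus[OF q, of q] E
    unfolding E1_def E2_def Q_def by (simp add: field_simps)
  have inf_C: "qpoch_inf (-Q) Q = E4 / E2"
    using qpoch_inf_mult_minus[OF Q, of Q] E
    unfolding E2_def E4_def by (simp add: field_simps Q_def)
  \<comment> \<open>Obtained by splitting (-q;q)_inf by parity and dividing by (-Q;Q)_inf.\<close>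
  have inf_B: "qpoch_inf (-q) Q = E2^2 / (E1 * E4)"
    using qpoch_inf_double[OF q, of "-q"] E
    unfolding inf_mq Q_def[symmetric] using inf_C
    by (simp add: Q_def field_simps power2_eq_square)
  have inf_A: "qpoch_inf (-1) Q = 2 * (E4 / E2)"
    using qpoch_inf_shift[OF Q, of "-1"] inf_C by simp
  have ratio: "qpoch_inf Q Q / qpoch_inf (-1) Q = E2^2 / E4 / 2"
    "qpoch_inf Q Q / qpoch_inf (-Q) Q = E2^2 / E4"
    "qpoch_inf Q Q / qpoch_inf (-q) Q = E1 * E4 / E2"
    unfolding inf_A inf_B inf_C E2_def[symmetric] using E by (simp_all add: power2_eq_square)
  define R where "R = E2 / E1^2"
  have R: "qpoch_inf (-q) q / qpoch_inf q q = R"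
    unfolding inf_mq R_def E1_def[symmetric] by (simp add: power2_eq_square)

  \<comment> \<open>The two transformed series\<close>
  have q_even_power: "q ^ (2 * n) = Q ^ n" for n by (simp add: Q_def power_mult)
  have even: "(\<lambda>n. A n * B n / (F n * D n) * Q ^ n) sums ((R + 1 / R) / 2)"
    using qpoch_minus_1_quotient_sums(1)[OF q] unfolding R m1_even q_even q_even_power
    by (simp add: mult_ac)
  \<comment> \<open>The odd part without its constant \<open>2 * q / (1 - q)\<close>; in this form
    it is the right side of two of the four transformations.\<close>
  define S where "S = (\<Sum>n. C n * B n / (F n * D' n) * Q ^ n)"
  have S: "(\<lambda>n. C n * B n / (F n * D' n) * Q ^ n) sums S"
    unfolding S_def defs by (intro summable_sums summable_norm_cancel[OF summable_norm_qpoch_quotient] Q)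
  have odd: "2 * q / (1 - q) * S = (R - 1 / R) / 2"
  proof -
    have "(\<lambda>n. 2 * q / (1 - q) * (C n * B n / (F n * D' n) * Q ^ n)) sums (2 * q / (1 - q) * S)"
      by (intro sums_mult S)
    moreover have "qpoch (-1) q (2 * n + 1) / qpoch q q (2 * n + 1) * q ^ (2 * n + 1)
        = 2 * q / (1 - q) * (C n * B n / (F n * D' n) * Q ^ n)" for n
      unfolding m1_odd q_odd A_Suc D_shift power_add q_even_power by (simp add: mult_ac)
    ultimately show ?thesis
      using qpoch_minus_1_quotient_sums(2)[OF q] unfolding R by (simp only: sums_unique2)
  qed
  then have odd4: "4 * q / (1 - q) * S = R - 1 / R" by (simp add: mult_ac)

  \<comment> \<open>The four applications of the transformation\<close>
  \<comment> \<open>\<open>t\<close> and \<open>u\<close> are the terms of the first and third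
    series; those of the second and fourth are \<open>q ^ (2 * k) * t k\<close> and
    \<open>q ^ (2 * k + 1) * u k\<close>.\<close>
  define t where "t k = q ^ (k^2) * qpoch (-1) q (2*k) * qpoch (-1) Q k / qpoch Q Q (2*k)" for k
  define u where "u k = q ^ (k^2 + k) * qpoch (-1) q (2*k+1) * qpoch (-q) Q k / qpoch Q Q (2*k+1)" for k
  have t: "t k = q ^ (k^2) * A k * A k / (D k * F k * C k)" for k
    unfolding t_def m1_even Q_even A_def[symmetric] using nz[of k] by (simp add: mult_ac)
  have u: "u k = 2 * q ^ (k^2 + k) * B k / (D (Suc k) * F k * (1 + q * Q ^ k))" for k
    unfolding u_def m1_odd Q_odd B_def[symmetric] B_Suc A_Suc using nz[of k] by (simp add: mult_ac)

  \<comment> \<open>Transformation with \<open>a = -1\<close>, \<open>y = -q\<close>,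
    \<open>b = -1\<close>, whose right side is the even part. The prefactor 2 is there because
    \<open>2 / (1 + Q ^ k) = A k / C k\<close>.\<close>
  have t2: "(\<lambda>k. q ^ (2 * k) * t k) sums (E2^2 / E4 * ((R + 1 / R) / 2))"
  proof -
    have "(\<lambda>k. 2 * (qexp_coeff Q k * (Q * - q) ^ k * qpoch (-1) Q k / qpoch (- q * -1) Q k
        / (1 - -1 * Q ^ k))) sums (2 * (qpoch_inf Q Q / qpoch_inf (-1) Q * ((R + 1 / R) / 2)))"
      by (intro sums_mult qhyper_transformation Q neA)
        (use ne1 q even in \<open>simp_all add: defs\<close>)
    moreover have "2 * (qexp_coeff Q k * (Q * - q) ^ k * qpoch (-1) Q k / qpoch (- q * -1) Q k
        / (1 - -1 * Q ^ k)) = q ^ (2 * k) * t k" for k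
    proof -
      have AC': "2 / (1 + Q ^ k) = A k / C k"
        using AC[of k] nz(3)[of k] q_power(5)[of k] by (simp add: frac_eq_eq)
      have "2 * (qexp_coeff Q k * (Q * - q) ^ k * qpoch (-1) Q k / qpoch (- q * -1) Q k
          / (1 - -1 * Q ^ k)) = q ^ (k^2 + k) * q ^ k * A k / (D k * F k) * (2 / (1 + Q ^ k))"
        unfolding Q_def qexp_coeff_square_power by (simp add: defs Q_def mult_ac)
      also have "\<dots> = q ^ (k^2) * (q ^ k * q ^ k) * A k / (D k * F k) * (A k / C k)"
        unfolding AC' power_add by (simp only: mult_ac)
      also have "q ^ k * q ^ k = q ^ (2 * k)" by (simp add: mult_2 power_add)
      finally show ?thesis unfolding t by (simp add: mult_ac)
    qed
    moreover have "2 * (qpoch_inf Q Q / qpoch_inf (-1) Q * ((R + 1 / R) / 2))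
        = E2^2 / E4 * ((R + 1 / R) / 2)"
      unfolding ratio by (simp add: mult_ac)
    ultimately show ?thesis by (simp only:)
  qed
  \<comment> \<open>Transformation with \<open>a = -Q\<close>, \<open>y = -q\<close>,
    \<open>b = -Q\<close>, leading to \<open>S\<close>. The term of index 0 vanishes, so the index
    is shifted; \<open>1 - q ^ (2 * Suc k)\<close> then cancels the last factor of
    \<open>F (Suc k)\<close>. In \<open>4 * q / (1 - q)\<close> the 4 comes from
    \<open>A (Suc k)\<close> squared, \<open>q\<close> from the exponent \<open>(Suc k)^2\<close>,
    and \<open>1 - q\<close> from \<open>D (Suc k)\<close>.\<close>
  have t1: "(\<lambda>k. t k - q ^ (2 * k) * t k) sums (E2^2 / E4 * (R - 1 / R))"
  proof (rule sums_Suc_imp)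
    have "(\<lambda>k. 4 * q / (1 - q) * (qexp_coeff Q k * (Q * - q) ^ k * qpoch (-Q) Q k / qpoch (- q * -Q) Q k
        / (1 - -Q * Q ^ k))) sums (4 * q / (1 - q) * (qpoch_inf Q Q / qpoch_inf (-Q) Q * S))"
      by (intro sums_mult qhyper_transformation Q)
        (use ne1[of "-Q"] ne1[of "q^3"] q3 Q S in \<open>simp_all add: defs Q_def power3_eq_cube power2_eq_square mult_ac\<close>)
    moreover have "4 * q / (1 - q) * (qexp_coeff Q k * (Q * - q) ^ k * qpoch (-Q) Q k / qpoch (- q * -Q) Q k
        / (1 - -Q * Q ^ k)) = t (Suc k) - q ^ (2 * Suc k) * t (Suc k)" for k
    proof -
      have q3_eq: "- q * - Q = q^3" by (simp add: Q_def power3_eq_cube power2_eq_square)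
      have "4 * q / (1 - q) * (qexp_coeff Q k * (Q * - q) ^ k * qpoch (-Q) Q k / qpoch (- q * -Q) Q k
          / (1 - -Q * Q ^ k)) = 4 * q / (1 - q) * (q ^ (k^2 + k) * q ^ k / F k * C k / D' k / (1 + Q * Q ^ k))"
        unfolding q3_eq unfolding Q_def qexp_coeff_square_power by (simp add: defs Q_def mult_ac)
      also have "\<dots> = q ^ ((Suc k)^2) * (2 * C k) * (2 * C k)
          / ((1 - q) * D' k * F k * (C k * (1 + Q * Q ^ k)))"
        using nz[of k] by (simp add: power2_eq_square power_add mult_ac)
      also have "\<dots> = (1 - Q * Q ^ k) * t (Suc k)"
        unfolding t A_Suc C_Suc D_shift F_Suc using q_power[of k] by simp
      also have "\<dots> = t (Suc k) - q ^ (2 * Suc k) * t (Suc k)"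
        unfolding q_even_power by (simp add: algebra_simps)
      finally show ?thesis .
    qed
    moreover have "4 * q / (1 - q) * (qpoch_inf Q Q / qpoch_inf (-Q) Q * S) = E2^2 / E4 * (R - 1 / R)"
      unfolding ratio odd4[symmetric] by (simp add: mult_ac)
    ultimately show "(\<lambda>k. t (Suc k) - q ^ (2 * Suc k) * t (Suc k)) sums (E2^2 / E4 * (R - 1 / R))"
      by (simp only:)
  qed simp
  \<comment> \<open>Transformation with \<open>a = -q\<close>, \<open>y = -Q\<close>,
    \<open>b = -q\<close>, again leading to \<open>S\<close>.\<close>
  have u2: "(\<lambda>k. q ^ (2 * k + 1) * u k) sums (E1 * E4 / E2 * ((R - 1 / R) / 2))"
  proof -
    have "(\<lambda>k. 2 * q / (1 - q) * (qexp_coeff Q k * (Q * - Q) ^ k * qpoch (-q) Q k / qpoch (- Q * -q) Q k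
        / (1 - -q * Q ^ k))) sums (2 * q / (1 - q) * (qpoch_inf Q Q / qpoch_inf (-q) Q * S))"
      by (intro sums_mult qhyper_transformation Q)
        (use ne1[of "-q"] ne1[of "q^3"] q3 q S in \<open>simp_all add: defs Q_def power3_eq_cube power2_eq_square mult_ac\<close>)
    moreover have "2 * q / (1 - q) * (qexp_coeff Q k * (Q * - Q) ^ k * qpoch (-q) Q k / qpoch (- Q * -q) Q k
        / (1 - -q * Q ^ k)) = q ^ (2 * k + 1) * u k" for k
    proof -
      have q3_eq: "- Q * - q = q^3" by (simp add: Q_def power3_eq_cube power2_eq_square)
      have "2 * q / (1 - q) * (qexp_coeff Q k * (Q * - Q) ^ k * qpoch (-q) Q k / qpoch (- Q * -q) Q k
          / (1 - -q * Q ^ k)) = 2 * q / (1 - q) * (q ^ (k^2 + k) * Q ^ k / F k * B k / D' k / (1 + q * Q ^ k))"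
        unfolding q3_eq unfolding Q_def qexp_coeff_square_power by (simp add: defs Q_def mult_ac)
      then show ?thesis
        unfolding u D_shift power_add q_even_power by (simp add: mult_ac)
    qed
    moreover have "2 * q / (1 - q) * (qpoch_inf Q Q / qpoch_inf (-q) Q * S)
        = E1 * E4 / E2 * ((R - 1 / R) / 2)"
      unfolding ratio odd[symmetric] by (simp add: mult_ac)
    ultimately show ?thesis by (simp only:)
  qed
  \<comment> \<open>Transformation with \<open>a = -q\<close>, \<open>y = -1\<close>,
    \<open>b = -q\<close>, leading to the even part; \<open>1 - q ^ (2 * k + 1)\<close> cancels the
    last factor of \<open>D (Suc k)\<close>.\<close>
  have u1: "(\<lambda>k. u k - q ^ (2 * k + 1) * u k) sums (E1 * E4 / E2 * (R + 1 / R))"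
  proof -
    have even': "(\<lambda>n. qpoch (-q) Q n * qpoch (-1) Q n / (qpoch Q Q n * qpoch (-1 * -q) Q n) * Q ^ n)
        sums ((R + 1 / R) / 2)"
      using even by (simp add: defs mult_ac)
    have "(\<lambda>k. 2 * (qexp_coeff Q k * (Q * - 1) ^ k * qpoch (-q) Q k / qpoch (- 1 * -q) Q k
        / (1 - -q * Q ^ k))) sums (2 * (qpoch_inf Q Q / qpoch_inf (-q) Q * ((R + 1 / R) / 2)))"
      by (intro sums_mult qhyper_transformation Q even')
        (use ne1[of "-q"] ne1[of q] q in simp_all)
    moreover have "2 * (qexp_coeff Q k * (Q * - 1) ^ k * qpoch (-q) Q k / qpoch (- 1 * -q) Q k
        / (1 - -q * Q ^ k)) = u k - q ^ (2 * k + 1) * u k" for k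
    proof -
      have "2 * (qexp_coeff Q k * (Q * - 1) ^ k * qpoch (-q) Q k / qpoch (- 1 * -q) Q k
          / (1 - -q * Q ^ k)) = 2 * (q ^ (k^2 + k) / F k * B k / D k / (1 + q * Q ^ k))"
        unfolding Q_def qexp_coeff_square_power by (simp add: defs Q_def mult_ac)
      also have "\<dots> = (1 - q * Q ^ k) * u k"
        unfolding u D_Suc using q_power[of k] by (simp add: mult_ac)
      also have "\<dots> = u k - q ^ (2 * k + 1) * u k"
        unfolding power_add q_even_power by (simp add: algebra_simps)
      finally show ?thesis .
    qed
    moreover have "2 * (qpoch_inf Q Q / qpoch_inf (-q) Q * ((R + 1 / R) / 2)) = E1 * E4 / E2 * (R + 1 / R)"
      unfolding ratio by simp
    ultimately show ?thesis by (simp only:)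
  qed

  \<comment> \<open>Evaluation in terms of the infinite products\<close>
  \<comment> \<open>Adding the difference series to the second one restores \<open>t\<close>. The
    coefficient 3 comes from (R - 1/R) + (R + 1/R)/2 = (3R - 1/R)/2.\<close>
  have sums1: "t sums ((3 * E2^3 / (E1^2 * E4) - E1^2 * E2 / E4) / 2)"
  proof -
    have "E2^2 / E4 * (R - 1 / R) + E2^2 / E4 * ((R + 1 / R) / 2)
        = (3 * E2^3 / (E1^2 * E4) - E1^2 * E2 / E4) / 2"
      unfolding R_def using E by (simp add: field_simps power2_eq_square power3_eq_cube)
    then show ?thesis using sums_add[OF t1 t2] by (simp only: diff_add_cancel)
  qed
  have sums2: "(\<lambda>k. q ^ (2 * k) * t k) sums ((E2^3 / (E1^2 * E4) + E1^2 * E2 / E4) / 2)"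
  proof -
    have "E2^2 / E4 * ((R + 1 / R) / 2) = (E2^3 / (E1^2 * E4) + E1^2 * E2 / E4) / 2"
      unfolding R_def using E by (simp add: field_simps power2_eq_square power3_eq_cube)
    then show ?thesis using t2 by (simp only: diff_add_cancel)
  qed
  \<comment> \<open>As for \<open>t\<close>, with the two combinations exchanged: (R + 1/R) + (R -
    1/R)/2 = (3R + 1/R)/2.\<close>
  have sums3: "u sums ((3 * E4 / E1 + E1^3 * E4 / E2^2) / 2)"
  proof -
    have "E1 * E4 / E2 * (R + 1 / R) + E1 * E4 / E2 * ((R - 1 / R) / 2)
        = (3 * E4 / E1 + E1^3 * E4 / E2^2) / 2"
      unfolding R_def using E by (simp add: field_simps power2_eq_square power3_eq_cube)
    then show ?thesis using sums_add[OF u1 u2] by (simp only: diff_add_cancel)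
  qed
  have sums4: "(\<lambda>k. q ^ (2 * k + 1) * u k) sums ((E4 / E1 - E1^3 * E4 / E2^2) / 2)"
  proof -
    have "E1 * E4 / E2 * ((R - 1 / R) / 2) = (E4 / E1 - E1^3 * E4 / E2^2) / 2"
      unfolding R_def using E by (simp add: field_simps power2_eq_square power3_eq_cube)
    then show ?thesis using u2 by (simp only: diff_add_cancel)
  qed
  have t_eq: "q ^ (2 * k) * t k
      = q ^ (k^2 + 2*k) * qpoch (-1) q (2*k) * qpoch (-1) Q k / qpoch Q Q (2*k)" for k
    unfolding t_def by (simp add: power_add mult_ac)
  have u_eq: "q ^ (2 * k + 1) * u k
      = q ^ (k^2 + 3*k + 1) * qpoch (-1) q (2*k+1) * qpoch (-q) Q k / qpoch Q Q (2*k+1)" for k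
  proof -
    have "q ^ (k^2 + 3*k + 1) = q ^ (2 * k + 1) * q ^ (k^2 + k)"
      by (simp flip: power_add) (simp add: algebra_simps)
    then show ?thesis unfolding u_def by (simp only: mult_ac times_divide_eq_right)
  qed
  show ?thesis
    using sums1[unfolded t_def[abs_def]] sums2[unfolded t_eq]
      sums3[unfolded u_def[abs_def]] sums4[unfolded u_eq]
    unfolding E1_def E2_def E4_def Q_def by (intro conjI)
qed

end
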